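(* Consider the Bayesian persuasion game in which all $N$ agents have identical priors ($\mathcal F_1=\cdots=\mathcal F_N=\mathcal F$, values independent), each agent receives constant utility $u_i(v)=1$ for every $v\in[0,1]$ when selected, and the number of agents selected is $k=1$. Then the price of anarchy is at most $4$; that is, $\mathrm{SW}^{\max}(\mathcal I)\le 4\,\mathrm{SW}(\mathcal Z)$ for every Nash equilibrium $\mathcal Z$.
   Context: Model. There are $N$ agents and a principal who selects $k$ agents (here $k=1$). Agent $i$ has a value $v_i\sim\mathcal F_i$, where $\mathcal F_i$ is a probability distribution on $[0,1]$; values are independent across agents. Agent $i$'s strategy is a signaling scheme $\mathcal Z_i=(\Sigma_i,\pi_i)$, where $\Sigma_i$ is a measurable space of signals and $\pi_i$ is a probability kernel from $[0,1]$ to $\Sigma_i$: given $v_i$, the signal $\sigma_i$ is drawn from $\pi_i(\cdot\mid v_i)$, independently across agents. Let $\boldsymbol\Pi$ be the law of $\boldsymbol\sigma=(\sigma_1,\dots,\sigma_N)$, let $e_i(\sigma_i)=\mathbb E[v_i\mid\sigma_i]$ be the posterior mean, and $e_{(1)}(\boldsymbol\sigma)\ge\cdots\ge e_{(N)}(\boldsymbol\sigma)$ the sorted posterior means. The principal selects the $k$ agents with the highest posterior means, breaking ties uniformly at random; $\rho_i(\boldsymbol\sigma)$ is the resulting probability that agent $i$ is selected. An agent selected with value $v$ gets utility $u_i(v)$, and otherwise $0$. For a strategy profile $\mathcal Z=(\mathcal Z_1,\dots,\mathcal Z_N)$: $u_i(\mathcal Z)=\mathbb E_{\boldsymbol\sigma\sim\boldsymbol\Pi}[\rho_i(\boldsymbol\sigma)\,\mathbb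 E[u_i(v_i)\mid\sigma_i]]$ and $\mathrm{SW}(\mathcal Z)=\mathbb E_{\boldsymbol\sigma\sim\boldsymbol\Pi}[\sum_{j=1}^k e_{(j)}(\boldsymbol\sigma)]$. $\mathcal Z$ is a Nash equilibrium if for every agent $i$ and every signaling scheme $\mathcal Z_i'$, $u_i(\mathcal Z)\ge u_i(\mathcal Z_i',\mathcal Z_{-i})$. The first-best welfare is $\mathrm{SW}^{\max}(\mathcal I)=\mathbb E[\max_{S\subseteq[N],|S|=k}\sum_{i\in S}v_i]$, and the price of anarchy is $\mathrm{SW}^{\max}(\mathcal I)/\inf_{\mathcal Z}\mathrm{SW}(\mathcal Z)$, the infimum over all Nash equilibria. *)

theory Defs
  imports "HOL-Probability.Probability"
begin

record game =
  agents :: nat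
  slots :: nat
  prior :: "nat \<Rightarrow> real measure"
  util :: "nat \<Rightarrow> real \<Rightarrow> real"

abbreviation unit_interval :: "real measure" where
  "unit_interval \<equiv> restrict_space borel {0..1}"

definition valid_game :: "game \<Rightarrow> bool" where
  "valid_game I \<longleftrightarrow> 1 \<le> slots I \<and> slots I \<le> agents I \<and>
     (\<forall>i<agents I. prob_space (prior I i) \<and> sets (prior I i) = sets unit_interval)"

text \<open>The measurable signal space is given as a measure whose values are irrelevant:
  only its carrier (any subset of the type) and its sigma-algebra matter.\<close>

record 's scheme =
  signals :: "'s measure"
  kernel :: "real \<Rightarrow> 's measure"

definition signaling_scheme :: "'s scheme \<Rightarrow> bool" where
  "signaling_scheme \<zeta> \<longleftrightarrow> kernel \<zeta> \<in> unit_interval \<rightarrow>\<^sub>M prob_algebra (signals \<zeta>)"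

type_synonym 's profile = "nat \<Rightarrow> 's scheme"

text \<open>Joint law of one agent's value and signal.\<close>

definition joint_law :: "real measure \<Rightarrow> 's scheme \<Rightarrow> (real \<times> 's) measure" where
  "joint_law F \<zeta> =
     F \<bind> (\<lambda>v. distr (kernel \<zeta> v) (unit_interval \<Otimes>\<^sub>M signals \<zeta>) (Pair v))"

text \<open>\<open>E[g(v) | \<sigma>]\<close>, as a random variable on the (value, signal) space that is measurable
  with respect to the sigma-algebra generated by the signal.\<close>

definition posterior :: "real measure \<Rightarrow> 's scheme \<Rightarrow> (real \<Rightarrow> real) \<Rightarrow> real \<times> 's \<Rightarrow> real" where
  "posterior F \<zeta> g =
     real_cond_exp (joint_law F \<zeta>)
       (vimage_algebra (space (joint_law F \<zeta>)) snd (signals \<zeta>)) (\<lambda>(v, s). g v)"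

text \<open>The (value, signal) pairs of the agents are independent. Expectations over the law of the
  signal profile are taken over this product space; the integrands depend on the signals only.\<close>

definition outcome_law :: "game \<Rightarrow> 's profile \<Rightarrow> (nat \<Rightarrow> real \<times> 's) measure" where
  "outcome_law I Z = Pi\<^sub>M {..<agents I} (\<lambda>i. joint_law (prior I i) (Z i))"

definition post_mean :: "game \<Rightarrow> 's profile \<Rightarrow> (nat \<Rightarrow> real \<times> 's) \<Rightarrow> nat \<Rightarrow> real" where
  "post_mean I Z \<omega> i = posterior (prior I i) (Z i) (\<lambda>v. v) (\<omega> i)"

text \<open>The sets of \<open>slots I\<close> agents with the highest scores \<open>e\<close>; there are several of them in
  case of a tie at the margin, and the principal picks one uniformly.\<close>

definition top_sets :: "game \<Rightarrow> (nat \<Rightarrow> real) \<Rightarrow> nat set set" where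
  "top_sets I e = {S. S \<subseteq> {..<agents I} \<and> card S = slots I \<and>
     (\<forall>i\<in>S. \<forall>j\<in>{..<agents I} - S. e j \<le> e i)}"

definition select_prob :: "game \<Rightarrow> (nat \<Rightarrow> real) \<Rightarrow> nat \<Rightarrow> real" where
  "select_prob I e i = measure_pmf.prob (pmf_of_set (top_sets I e)) {S. i \<in> S}"

text \<open>\<open>e\<^sub>(\<^sub>j\<^sub>)\<close>, the \<open>j\<close>-th largest score, for \<open>j\<close> from 1.\<close>

definition ordered :: "game \<Rightarrow> (nat \<Rightarrow> real) \<Rightarrow> nat \<Rightarrow> real" where
  "ordered I e j = rev (sort (map e [0..<agents I])) ! (j - 1)"

definition payoff :: "game \<Rightarrow> 's profile \<Rightarrow> nat \<Rightarrow> real" where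
  "payoff I Z i =
     (\<integral>\<omega>. select_prob I (post_mean I Z \<omega>) i * posterior (prior I i) (Z i) (util I i) (\<omega> i)
        \<partial>outcome_law I Z)"

definition welfare :: "game \<Rightarrow> 's profile \<Rightarrow> real" where
  "welfare I Z = (\<integral>\<omega>. (\<Sum>j=1..slots I. ordered I (post_mean I Z \<omega>) j) \<partial>outcome_law I Z)"

text \<open>Deviations range over all measurable signal spaces carried by subsets of \<open>'s\<close>, so this notion
  is the intended one only when \<open>'s\<close> is large enough. As a posterior mean is a sufficient signal,
  cardinality at least that of the reals suffices to represent every scheme.\<close>

definition nash_equilibrium :: "game \<Rightarrow> 's profile \<Rightarrow> bool" where
  "nash_equilibrium I Z \<longleftrightarrow> (\<forall>i<agents I. signaling_scheme (Z i)) \<and>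
     (\<forall>i<agents I. \<forall>\<zeta>. signaling_scheme \<zeta> \<longrightarrow> payoff I (Z(i := \<zeta>)) i \<le> payoff I Z i)"

definition max_welfare :: "game \<Rightarrow> real" where
  "max_welfare I =
     (\<integral>v. Max ((\<lambda>S. \<Sum>i\<in>S. v i) ` {S. S \<subseteq> {..<agents I} \<and> card S = slots I})
        \<partial>Pi\<^sub>M {..<agents I} (prior I))"

text \<open>The equilibria range over profiles whose signals are drawn from the type \<open>'s\<close>.
  In \<^typ>\<open>ennreal\<close>, \<open>0 / 0 = 0\<close> (all values almost surely zero) and \<open>x / \<infinity> = 0\<close>
  (no equilibrium), so in both cases the ratio does not exceed any bound.\<close>

definition price_of_anarchy :: "'s itself \<Rightarrow> game \<Rightarrow> ennreal" where
  "price_of_anarchy _ I = ennreal (max_welfare I) /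
     (INF Z\<in>{Z :: 's profile. nash_equilibrium I Z}. ennreal (welfare I Z))"

end

theory Submission
  imports Defs
begin

text \<open>
  Selection probabilities sum to 1, so in an equilibrium some agent \<open>i\<close> has payoff at most \<open>1/N\<close>.
  Let \<open>i\<close> deviate to revealing only whether its value lies in the top \<open>2/N\<close>-quantile, and let
  \<open>m\<close> be the posterior mean of that event. The deviation wins whenever the event occurs and all other
  posterior means are below \<open>m\<close>; by independence the latter has probability at most \<open>1/2\<close>, and hence the
  equilibrium welfare is at least \<open>m/2\<close>. On the other hand, for the quantile threshold \<open>t\<close>,
  \<open>max v\<^sub>i \<le> t + (\<Sum>i. max 0 (v\<^sub>i - t))\<close> gives a first-best welfare of at most
  \<open>t + N E[max 0 (v - t)] \<le> 2 (t + N/2 E[max 0 (v - t)]) = 2 m\<close>.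
  The case \<open>N = 1\<close>, where a \<open>2/N\<close>-quantile does not exist, is trivial.
\<close>

subsection \<open>Product measures, fibres and quantiles\<close>

lemma measure_PiM_box:
  assumes "finite I" "\<And>i. i \<in> I \<Longrightarrow> prob_space (M i)" "\<And>i. i \<in> I \<Longrightarrow> A i \<in> sets (M i)"
  shows "measure (Pi\<^sub>M I M) (Pi\<^sub>E I A) = (\<Prod>i\<in>I. measure (M i) (A i))"
proof -
  have "Pi\<^sub>E I A = prod_emb I M I (Pi\<^sub>E I A)"
    using assms(3) by (subst prod_emb_id) (auto simp: PiE_def Pi_def dest: sets.sets_into_space)
  then have "emeasure (Pi\<^sub>M I M) (Pi\<^sub>E I A) = (\<Prod>i\<in>I. emeasure (M i) (A i))"
    using emeasure_PiM_emb[of I M I A] assms by auto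
  also have "\<dots> = (\<Prod>i\<in>I. ennreal (measure (M i) (A i)))"
    using assms(2) by (intro prod.cong refl finite_measure.emeasure_eq_measure prob_space.finite_measure)
  finally show ?thesis
    by (simp add: prod_ennreal measure_def prod_nonneg)
qed

text \<open>The preimage of \<open>{h x}\<close> under \<open>h\<close> is measurable for the
  generated sigma-algebra, hence a preimage under \<open>f\<close>, and such a set contains each
  fibre of \<open>f\<close> that it meets. With \<open>f = snd\<close> this makes a posterior mean a
  genuine function of the signal, at every point.\<close>

lemma measurable_vimage_algebra_fibre:
  fixes h :: "'a \<Rightarrow> 'b::t1_space"
  assumes "f \<in> X \<rightarrow> space M" and h: "h \<in> borel_measurable (vimage_algebra X f M)"
    and "x \<in> X" "y \<in> X" "f x = f y"
  shows "h x = h y"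
proof -
  have "h -` {h x} \<inter> X \<in> sets (vimage_algebra X f M)"
    using measurable_sets[OF h, of "{h x}"] by simp
  then obtain B where B: "h -` {h x} \<inter> X = f -` B \<inter> X"
    using assms(1) by (auto simp: sets_vimage_algebra2)
  have "x \<in> h -` {h x} \<inter> X" using assms by simp
  then have "y \<in> f -` B \<inter> X" using assms unfolding B by simp
  then show ?thesis unfolding B[symmetric] by simp
qed

text \<open>Take \<open>t\<close> as the supremum of the levels that \<open>X\<close> reaches with
  probability at least \<open>q\<close>. Continuity of the measure, from above along
  \<open>t - 1/(n+1)\<close> and from below along \<open>t + 1/(n+1)\<close>, transfers the bounds
  at nearby levels to \<open>t\<close>. Both inequalities are needed because the distribution may
  have an atom at \<open>t\<close>.\<close>

lemma (in prob_space) quantile_exists: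
  assumes rv: "X \<in> borel_measurable M" and bounds: "\<And>x. x \<in> space M \<Longrightarrow> 0 \<le> X x \<and> X x \<le> b"
    and q: "0 < q" "q \<le> 1"
  obtains t :: real where "0 \<le> t" "prob {x\<in>space M. t < X x} \<le> q" "q \<le> prob {x\<in>space M. t \<le> X x}"
proof -
  note [measurable] = rv
  define S where "S = {t. q \<le> prob {x\<in>space M. t \<le> X x}}"
  define t where "t = Sup S"
  \<comment> \<open>\<open>S\<close> contains 0 because X \<ge> 0, and is bounded by
    \<open>b\<close> because levels above \<open>b\<close> are reached with probability 0 < q. So
    \<open>Sup S\<close> is a true supremum.\<close>
  have "{x\<in>space M. 0 \<le> X x} = space M" using bounds by auto
  then have 0: "0 \<in> S" using q by (simp add: S_def prob_space)
  have "s \<le> b" if "s \<in> S" for s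
  proof (rule ccontr)
    assume "\<not> s \<le> b"
    then have e: "{x\<in>space M. s \<le> X x} = {}" using bounds by force
    have "q \<le> prob {}" using that unfolding S_def mem_Collect_eq e .
    then show False using q by simp
  qed
  then have bdd: "bdd_above S" by (auto simp: bdd_above_def)
  have "0 \<le> t" unfolding t_def using 0 bdd by (rule cSup_upper)
  have inv: "1 / real (Suc n) > 0" for n by simp
  have up: "prob {x\<in>space M. t + 1 / real (Suc n) \<le> X x} \<le> q" for n
  proof (rule ccontr)
    assume "\<not> ?thesis"
    then have "t + 1 / real (Suc n) \<le> t" unfolding t_def using bdd
      by (intro cSup_upper) (auto simp: S_def)
    then show False using inv[of n] by linarith
  qed
  have down: "q \<le> prob {x\<in>space M. t - 1 / real (Suc n) \<le> X x}" for n
  proof -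
    obtain s where s: "s \<in> S" "t - 1 / real (Suc n) < s"
      using less_cSup_iff[of S "t - 1 / real (Suc n)"] 0 bdd inv[of n] unfolding t_def by (metis diff_less_eq empty_iff less_add_same_cancel1)
    have "prob {x\<in>space M. s \<le> X x} \<le> prob {x\<in>space M. t - 1 / real (Suc n) \<le> X x}"
      using s by (intro finite_measure_mono) auto
    then show ?thesis using s unfolding S_def by simp
  qed
  have lim: "(\<lambda>n. 1 / real (Suc n)) \<longlonglongrightarrow> 0"
    using LIMSEQ_inverse_real_of_nat by (simp add: inverse_eq_divide)
  have mono: "1 / real (Suc n) \<le> 1 / real (Suc m)" if "m \<le> n" for m n
    using that by (intro divide_left_mono) auto
  have "(\<lambda>n. prob {x\<in>space M. t - 1 / real (Suc n) \<le> X x}) \<longlonglongrightarrow>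
      prob (\<Inter>n. {x\<in>space M. t - 1 / real (Suc n) \<le> X x})"
    by (intro finite_Lim_measure_decseq) (auto simp: decseq_def dest: mono intro: order_trans[rotated] diff_left_mono)
  also have "(\<Inter>n. {x\<in>space M. t - 1 / real (Suc n) \<le> X x}) = {x\<in>space M. t \<le> X x}"
  proof (intro set_eqI iffI)
    fix x assume x: "x \<in> (\<Inter>n. {x\<in>space M. t - 1 / real (Suc n) \<le> X x})"
    have "(\<lambda>n. t - 1 / real (Suc n)) \<longlonglongrightarrow> t - 0"
      by (intro tendsto_intros lim)
    then have "t \<le> X x" using x by (intro LIMSEQ_le_const2[of _ t "X x"]) auto
    then show "x \<in> {x\<in>space M. t \<le> X x}" using x by auto
  next
    fix x assume "x \<in> {x\<in>space M. t \<le> X x}"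
    then show "x \<in> (\<Inter>n. {x\<in>space M. t - 1 / real (Suc n) \<le> X x})"
      by (auto intro: order_trans[rotated])
  qed
  finally have ge: "q \<le> prob {x\<in>space M. t \<le> X x}"
    by (rule LIMSEQ_le_const) (use down in auto)
  have "(\<lambda>n. prob {x\<in>space M. t + 1 / real (Suc n) \<le> X x}) \<longlonglongrightarrow>
      prob (\<Union>n. {x\<in>space M. t + 1 / real (Suc n) \<le> X x})"
    by (intro finite_Lim_measure_incseq) (auto simp: incseq_def dest: mono intro: order_trans[rotated])
  also have "(\<Union>n. {x\<in>space M. t + 1 / real (Suc n) \<le> X x}) = {x\<in>space M. t < X x}"
  proof (intro set_eqI iffI)
    fix x assume "x \<in> (\<Union>n. {x\<in>space M. t + 1 / real (Suc n) \<le> X x})"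
    then obtain n where "x \<in> space M" "t + 1 / real (Suc n) \<le> X x" by auto
    moreover from this have "t < X x" using inv[of n] by linarith
    ultimately show "x \<in> {x\<in>space M. t < X x}" by simp
  next
    fix x assume x: "x \<in> {x\<in>space M. t < X x}"
    then obtain n where "inverse (real (Suc n)) < X x - t"
      using reals_Archimedean[of "X x - t"] by auto
    then have "t + 1 / real (Suc n) \<le> X x" by (simp add: inverse_eq_divide)
    then show "x \<in> (\<Union>n. {x\<in>space M. t + 1 / real (Suc n) \<le> X x})"
      using x by blast
  qed
  finally have le: "prob {x\<in>space M. t < X x} \<le> q"
    by (rule LIMSEQ_le_const2) (use up in auto)
  show thesis by (rule that) fact+
qed

text \<open>\<open>w\<close> is the upper \<open>q\<close>-quantile event, randomized at the threshold to give it mass exactly \<open>q\<close>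
  even if the distribution has an atom there.\<close>

lemma (in prob_space) randomized_threshold:
  assumes rv: "X \<in> borel_measurable M" and bounds: "\<And>x. x \<in> space M \<Longrightarrow> 0 \<le> X x \<and> X x \<le> b"
    and q: "0 < q" "q \<le> 1"
  obtains t :: real and w :: "real \<Rightarrow> real" where "0 \<le> t" "w \<in> borel_measurable borel"
    "range w \<subseteq> {0..1}" "(\<integral>x. w (X x) \<partial>M) = q"
    "(\<integral>x. X x * w (X x) \<partial>M) = t * q + (\<integral>x. max 0 (X x - t) \<partial>M)"
proof -
  note [measurable] = rv
  obtain t where t: "0 \<le> t" "prob {x\<in>space M. t < X x} \<le> q" "q \<le> prob {x\<in>space M. t \<le> X x}"
    using quantile_exists[OF rv bounds q] by metis
  let ?A = "{x\<in>space M. t < X x}" and ?B = "{x\<in>space M. X x = t}"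
  have "{x\<in>space M. t \<le> X x} = ?A \<union> ?B" by auto
  then have sum: "prob {x\<in>space M. t \<le> X x} = prob ?A + prob ?B"
    by (simp only:) (intro finite_measure_Union; force)
  \<comment> \<open>\<open>c\<close> is the share of the atom at \<open>t\<close> that raises the
    mass from \<open>prob ?A\<close> to \<open>q\<close>. If the atom is null, the two quantile
    inequalities already force \<open>prob ?A = q\<close>.\<close>
  define c where "c = (if prob ?B = 0 then 0 else (q - prob ?A) / prob ?B)"
  have c: "0 \<le> c" "c \<le> 1" "prob ?A + c * prob ?B = q"
    using t(2,3) sum by (auto simp: c_def divide_simps measure_nonneg zero_less_measure_iff)
  define w where "w v = indicator {t<..} v + c * indicator {t} v" for v :: real
  have w_meas[measurable]: "w \<in> borel_measurable borel" unfolding w_def by measurable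
  have w: "0 \<le> w v" "w v \<le> 1" for v using c by (auto simp: w_def indicator_def)
  have "(\<integral>x. w (X x) \<partial>M) = (\<integral>x. indicator ?A x + c * indicator ?B x \<partial>M)"
    by (intro Bochner_Integration.integral_cong refl) (auto simp: w_def indicator_def)
  also have "\<dots> = prob ?A + c * prob ?B"
    by (subst Bochner_Integration.integral_add)
      (auto intro!: integrable_mult_right integrable_real_indicator simp: emeasure_eq_measure)
  finally have int_w: "(\<integral>x. w (X x) \<partial>M) = q" using c by simp
  \<comment> \<open>Above \<open>t\<close> the weight is 1, at \<open>t\<close> the excess is 0, and
    below \<open>t\<close> both the weight and the excess vanish.\<close>
  have "X x * w (X x) = t * w (X x) + max 0 (X x - t)" for x
    by (auto simp: w_def indicator_def algebra_simps)
  then have "(\<integral>x. X x * w (X x) \<partial>M) = (\<integral>x. t * w (X x) + max 0 (X x - t) \<partial>M)" by simp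
  also have "\<dots> = (\<integral>x. t * w (X x) \<partial>M) + (\<integral>x. max 0 (X x - t) \<partial>M)"
  proof (rule Bochner_Integration.integral_add)
    show "integrable M (\<lambda>x. t * w (X x))"
      using w by (intro integrable_mult_right integrable_const_bound[where B=1]) auto
    show "integrable M (\<lambda>x. max 0 (X x - t))"
    proof (rule integrable_const_bound[where B=b])
      show "AE x in M. norm (max 0 (X x - t)) \<le> b"
      proof (rule AE_I2)
        fix x assume "x \<in> space M"
        then show "norm (max 0 (X x - t)) \<le> b" using bounds[of x] t(1) by auto
      qed
    qed measurable
  qed
  also have "(\<integral>x. t * w (X x) \<partial>M) = t * q" by (simp add: int_w)
  finally have "(\<integral>x. X x * w (X x) \<partial>M) = t * q + (\<integral>x. max 0 (X x - t) \<partial>M)" .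
  moreover have "range w \<subseteq> {0..1}" using w by auto
  ultimately show thesis using that t(1) w_meas int_w by blast
qed

subsection \<open>The law of a single agent\<close>

locale agent = prob_space F for F :: "real measure" +
  fixes \<zeta> :: "'s scheme"
  assumes sets_prior: "sets F = sets unit_interval"
    and scheme: "signaling_scheme \<zeta>"
begin

abbreviation J :: "(real \<times> 's) measure" where "J \<equiv> joint_law F \<zeta>"
abbreviation G :: "(real \<times> 's) measure" where "G \<equiv> vimage_algebra (space J) snd (signals \<zeta>)"

lemma space_prior: "space F = {0..1}"
  using sets_eq_imp_space_eq[OF sets_prior] by (simp add: space_restrict_space)

lemma kernel_measurable: "kernel \<zeta> \<in> F \<rightarrow>\<^sub>M prob_algebra (signals \<zeta>)"
  using scheme sets_prior unfolding signaling_scheme_def by (simp cong: measurable_cong_sets)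

lemma pair_kernel_measurable:
  "(\<lambda>v. distr (kernel \<zeta> v) (unit_interval \<Otimes>\<^sub>M signals \<zeta>) (Pair v))
     \<in> F \<rightarrow>\<^sub>M prob_algebra (unit_interval \<Otimes>\<^sub>M signals \<zeta>)"
proof (rule measurable_distr_prob_space2[OF kernel_measurable])
  have "sets (F \<Otimes>\<^sub>M signals \<zeta>) = sets (unit_interval \<Otimes>\<^sub>M signals \<zeta>)"
    by (intro sets_pair_measure_cong sets_prior refl)
  then show "case_prod Pair \<in> F \<Otimes>\<^sub>M signals \<zeta> \<rightarrow>\<^sub>M unit_interval \<Otimes>\<^sub>M signals \<zeta>"
    by (simp cong: measurable_cong_sets)
qed

lemma prior_in_prob_algebra: "F \<in> space (prob_algebra F)"
  by (simp add: space_prob_algebra prob_space_axioms)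

lemma sets_joint_law: "sets J = sets (unit_interval \<Otimes>\<^sub>M signals \<zeta>)"
  unfolding joint_law_def
  by (rule sets_bind'[OF prior_in_prob_algebra pair_kernel_measurable])

lemma space_joint_law: "space J = {0..1} \<times> space (signals \<zeta>)"
  using sets_eq_imp_space_eq[OF sets_joint_law] by (simp add: space_pair_measure space_restrict_space)

text \<open>Disintegration along the kernel: first average over the signal given the value, then
  over the value. The value marginal and the binary scheme are both computed from it.\<close>

lemma nn_integral_joint_law:
  assumes f: "f \<in> borel_measurable J"
  shows "(\<integral>\<^sup>+x. f x \<partial>J) = (\<integral>\<^sup>+v. \<integral>\<^sup>+s. f (v, s) \<partial>kernel \<zeta> v \<partial>F)"
proof -
  have f': "f \<in> borel_measurable (unit_interval \<Otimes>\<^sub>M signals \<zeta>)"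
    using f sets_joint_law by (simp cong: measurable_cong_sets)
  have "(\<integral>\<^sup>+x. f x \<partial>J) =
      (\<integral>\<^sup>+v. \<integral>\<^sup>+x. f x \<partial>distr (kernel \<zeta> v) (unit_interval \<Otimes>\<^sub>M signals \<zeta>) (Pair v) \<partial>F)"
    unfolding joint_law_def
    by (rule nn_integral_bind[OF f' measurable_prob_algebraD[OF pair_kernel_measurable]])
  also have "\<dots> = (\<integral>\<^sup>+v. \<integral>\<^sup>+s. f (v, s) \<partial>kernel \<zeta> v \<partial>F)"
  proof (intro nn_integral_cong nn_integral_distr)
    fix v assume v: "v \<in> space F"
    then have "sets (kernel \<zeta> v) = sets (signals \<zeta>)"
      using measurable_space[OF kernel_measurable] by (simp add: space_prob_algebra)
    moreover have "Pair v \<in> signals \<zeta> \<rightarrow>\<^sub>M unit_interval \<Otimes>\<^sub>M signals \<zeta>"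
      using v by (intro measurable_Pair1') (simp add: space_prior space_restrict_space)
    ultimately show "Pair v \<in> kernel \<zeta> v \<rightarrow>\<^sub>M unit_interval \<Otimes>\<^sub>M signals \<zeta>"
      by (simp cong: measurable_cong_sets)
    show "f \<in> borel_measurable (distr (kernel \<zeta> v) (unit_interval \<Otimes>\<^sub>M signals \<zeta>) (Pair v))"
      using f' by simp
  qed
  finally show ?thesis .
qed

section \<open>Marginals of the joint law and the sigma-algebra of the signal\<close>

lemma fst_measurable: "fst \<in> J \<rightarrow>\<^sub>M F"
  using sets_joint_law sets_prior by (simp cong: measurable_cong_sets)

lemma snd_measurable: "snd \<in> J \<rightarrow>\<^sub>M signals \<zeta>"
  using sets_joint_law by (simp cong: measurable_cong_sets)

text \<open>Every \<open>kernel \<zeta> v\<close> has total mass 1, so integrating out the signal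
  leaves the prior.\<close>

lemma distr_joint_law_fst: "distr J F fst = F"
proof (rule measure_eqI)
  fix A assume "A \<in> sets (distr J F fst)"
  then have A: "A \<in> sets F" by simp
  have "emeasure (distr J F fst) A = (\<integral>\<^sup>+x. indicator A (fst x) \<partial>J)"
    using A fst_measurable by (simp add: nn_integral_distr flip: nn_integral_indicator)
  also have "\<dots> = (\<integral>\<^sup>+v. \<integral>\<^sup>+s. indicator A v \<partial>kernel \<zeta> v \<partial>F)"
    using A fst_measurable
    by (subst nn_integral_joint_law) (auto intro!: measurable_compose[OF fst_measurable])
  also have "\<dots> = (\<integral>\<^sup>+v. indicator A v \<partial>F)"
  proof (intro nn_integral_cong)
    fix v assume "v \<in> space F"
    then interpret K: prob_space "kernel \<zeta> v"
      using measurable_space[OF kernel_measurable] by (simp add: space_prob_algebra)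
    show "(\<integral>\<^sup>+s. indicator A v \<partial>kernel \<zeta> v) = (indicator A v :: ennreal)"
      by (simp add: K.emeasure_space_1)
  qed
  also have "\<dots> = emeasure F A" using A by simp
  finally show "emeasure (distr J F fst) A = emeasure F A" .
qed simp

sublocale J: prob_space J
proof -
  \<comment> \<open>An image measure has the same total mass as the original, so \<open>J\<close>
    inherits mass 1 from its value marginal.\<close>
  have "prob_space (distr J F fst)" by (simp add: distr_joint_law_fst prob_space_axioms)
  then show "prob_space J" by (rule prob_space_distrD[OF fst_measurable])
qed

lemma prob_space_joint_law: "prob_space J"
  by (rule J.prob_space_axioms)

sublocale J: finite_measure_subalgebra J G
  using snd_measurable
  by unfold_locales (auto simp: subalgebra_def measurable_iff_sets)

lemma integral_joint_law_fst:
  fixes g :: "real \<Rightarrow> real"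
  assumes "g \<in> borel_measurable F"
  shows "(\<integral>x. g (fst x) \<partial>J) = (\<integral>v. g v \<partial>F)"
  using integral_distr[OF fst_measurable assms] by (simp add: distr_joint_law_fst)

lemma id_measurable: "(\<lambda>v. v) \<in> borel_measurable F"
  using sets_prior by (simp add: measurable_restrict_space1 cong: measurable_cong_sets)

lemma fst_borel_measurable: "fst \<in> borel_measurable J"
  using measurable_comp[OF fst_measurable id_measurable] by (simp add: comp_def)

lemma fst_bounds: "x \<in> space J \<Longrightarrow> 0 \<le> fst x \<and> fst x \<le> 1"
  by (auto simp: space_joint_law)

lemma integrable_fst: "integrable J fst"
  using fst_borel_measurable fst_bounds
  by (intro J.integrable_const_bound[where B=1]) (auto intro!: AE_I2)

section \<open>Posterior expectations\<close>

lemma posterior_measurable: "posterior F \<zeta> g \<in> borel_measurable J"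
  unfolding posterior_def by (rule borel_measurable_cond_exp2)

lemma posterior_mean_eq: "posterior F \<zeta> (\<lambda>v. v) = real_cond_exp J G fst"
  unfolding posterior_def by (simp add: case_prod_unfold)

lemma AE_posterior_one:
  assumes "\<And>v. v \<in> {0..1} \<Longrightarrow> g v = 1"
  shows "AE x in J. posterior F \<zeta> g x = 1"
proof -
  \<comment> \<open>\<open>g\<close> is arbitrary outside the unit interval, so its measurability on
    \<open>J\<close> has to come from its agreement with the constant 1 on
    \<open>space J\<close>.\<close>
  have m: "(\<lambda>(v, s). g v) \<in> borel_measurable J \<longleftrightarrow> (\<lambda>x. 1 :: real) \<in> borel_measurable J"
    using assms by (intro measurable_cong) (auto simp: space_joint_law)
  have "AE x in J. real_cond_exp J G (\<lambda>(v, s). g v) x = real_cond_exp J G (\<lambda>x. 1) x"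
    using assms m by (intro J.real_cond_exp_cong AE_I2) (auto simp: space_joint_law)
  moreover have "AE x in J. real_cond_exp J G (\<lambda>x. 1) x = 1"
    by (intro J.real_cond_exp_F_meas) auto
  ultimately show ?thesis unfolding posterior_def by eventually_elim simp
qed

lemma AE_posterior_mean_nonneg: "AE x in J. 0 \<le> posterior F \<zeta> (\<lambda>v. v) x"
  unfolding posterior_mean_eq
  using fst_borel_measurable fst_bounds by (intro J.real_cond_exp_pos AE_I2) auto

lemma integrable_posterior_mean: "integrable J (posterior F \<zeta> (\<lambda>v. v))"
  unfolding posterior_mean_eq by (intro J.real_cond_exp_int integrable_fst)

lemma integral_posterior_mean: "(\<integral>x. posterior F \<zeta> (\<lambda>v. v) x \<partial>J) = (\<integral>v. v \<partial>F)"
  using J.real_cond_exp_int(2)[OF integrable_fst] integral_joint_law_fst[OF id_measurable]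
  by (simp add: posterior_mean_eq)

text \<open>The posterior mean is constant on the event that the signal is \<open>a\<close>, so the
  averaging property of conditional expectation over this event determines it. The product form
  avoids division by a possibly zero mass.\<close>

lemma posterior_mean_atom:
  assumes "{a} \<in> sets (signals \<zeta>)" and x: "x \<in> space J" "snd x = a"
  shows "posterior F \<zeta> (\<lambda>v. v) x * measure J {y\<in>space J. snd y = a} =
    (\<integral>y. indicator {y\<in>space J. snd y = a} y * fst y \<partial>J)"
proof -
  let ?A = "{y\<in>space J. snd y = a}"
  have "?A = snd -` {a} \<inter> space J" by auto
  then have A: "?A \<in> sets G" using in_vimage_algebra[OF assms(1)] by simp
  then have A': "?A \<in> sets J" using J.subalg by (auto simp: subalgebra_def)
  \<comment> \<open>Constancy holds at every point and not just almost everywhere, since the chosen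
    version of the conditional expectation is measurable for \<open>G\<close>.\<close>
  have const: "posterior F \<zeta> (\<lambda>v. v) y = posterior F \<zeta> (\<lambda>v. v) x" if "y \<in> ?A" for y
  proof (rule measurable_vimage_algebra_fibre[of snd "space J" "signals \<zeta>"])
    show "snd \<in> space J \<rightarrow> space (signals \<zeta>)" by (auto simp: space_joint_law)
    show "posterior F \<zeta> (\<lambda>v. v) \<in> borel_measurable G" unfolding posterior_def by simp
  qed (use that x in auto)
  have "(\<integral>y. indicator ?A y * fst y \<partial>J) = (\<integral>y. indicator ?A y * posterior F \<zeta> (\<lambda>v. v) y \<partial>J)"
    using J.real_cond_exp_intA[OF integrable_fst A]
    by (simp add: posterior_mean_eq set_lebesgue_integral_def)
  also have "\<dots> = (\<integral>y. indicator ?A y * posterior F \<zeta> (\<lambda>v. v) x \<partial>J)"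
    using const by (intro Bochner_Integration.integral_cong refl) (auto simp: indicator_def)
  also have "\<dots> = posterior F \<zeta> (\<lambda>v. v) x * measure J ?A"
    using A' by simp
  finally show ?thesis by simp
qed

end

text \<open>The kernel sends value \<open>v\<close> to \<open>hi\<close> with probability
  \<open>w v\<close> and to \<open>lo\<close> otherwise. With \<open>w\<close> a randomized
  threshold, this is the deviation that reveals membership in the upper quantile.\<close>

lemma binary_scheme:
  fixes hi lo :: 's
  assumes "hi \<noteq> lo" and F: "prob_space F" "sets F = sets unit_interval"
    and w_meas: "w \<in> borel_measurable unit_interval" and w_range: "range w \<subseteq> {0..1}"
  obtains \<zeta> :: "'s scheme" where "agent F \<zeta>" "{hi} \<in> sets (signals \<zeta>)"
    "measure (joint_law F \<zeta>) {x\<in>space (joint_law F \<zeta>). snd x = hi} = (\<integral>v. w v \<partial>F)"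
    "(\<integral>x. indicator {x\<in>space (joint_law F \<zeta>). snd x = hi} x * fst x \<partial>joint_law F \<zeta>) = (\<integral>v. v * w v \<partial>F)"
proof -
  have w: "w \<in> borel_measurable unit_interval" "\<And>v. 0 \<le> w v" "\<And>v. w v \<le> 1"
    using w_meas w_range by (auto simp: image_subset_iff)
  define K where "K v = map_pmf (\<lambda>b. if b then hi else lo) (bernoulli_pmf (w v))" for v
  define \<zeta> where "\<zeta> = \<lparr>signals = count_space (UNIV :: 's set), kernel = \<lambda>v. measure_pmf (K v)\<rparr>"
  have nnK: "(\<integral>\<^sup>+s. f s \<partial>K v) = ennreal (w v) * f hi + ennreal (1 - w v) * f lo" for f v
    using w(2,3) by (simp add: K_def nn_integral_bernoulli_pmf mult.commute)
  have "(\<lambda>v. measure_pmf (K v)) \<in> unit_interval \<rightarrow>\<^sub>M prob_algebra (count_space UNIV)"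
  proof (rule measurable_prob_algebraI)
    show "(\<lambda>v. measure_pmf (K v)) \<in> unit_interval \<rightarrow>\<^sub>M subprob_algebra (count_space UNIV)"
    proof (rule measurable_subprob_algebra)
      fix A :: "'s set"
      have "emeasure (K v) A = ennreal (w v) * indicator A hi + ennreal (1 - w v) * indicator A lo" for v
        using nnK[of v "indicator A"] by simp
      then show "(\<lambda>v. emeasure (K v) A) \<in> borel_measurable unit_interval"
        using w(1) by simp
    qed (auto intro: measure_pmf.subprob_space_axioms)
  qed (rule measure_pmf.prob_space_axioms)
  then interpret agent F \<zeta>
    using F by (intro agent.intro agent_axioms.intro) (auto simp: signaling_scheme_def \<zeta>_def)
  have hi: "{hi} \<in> sets (signals \<zeta>)" by (simp add: \<zeta>_def)
  have space_J: "space J = {0..1} \<times> UNIV"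
    unfolding space_joint_law by (simp add: \<zeta>_def)
  let ?A = "{x\<in>space J. snd x = hi}"
  have A: "?A \<in> sets J"
    using measurable_sets[OF snd_measurable hi] by (simp add: vimage_def Int_def conj_commute)
  note wF = w(1)[folded measurable_cong_sets[OF sets_prior refl]]
  \<comment> \<open>For \<open>g = 1\<close> this yields the mass of the event \<open>?A\<close>,
    and for the identity it yields the integral of the value over \<open>?A\<close>.\<close>
  have I: "(\<integral>\<^sup>+x. indicator ?A x * g (fst x) \<partial>J) = (\<integral>\<^sup>+v. ennreal (w v) * g v \<partial>F)"
    if g: "g \<in> borel_measurable F" for g :: "real \<Rightarrow> ennreal"
  proof -
    have "(\<integral>\<^sup>+x. indicator ?A x * g (fst x) \<partial>J) =
        (\<integral>\<^sup>+v. \<integral>\<^sup>+s. indicator ?A (v, s) * g v \<partial>K v \<partial>F)"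
      using A measurable_comp[OF fst_measurable g]
      by (subst nn_integral_joint_law) (auto simp: comp_def \<zeta>_def)
    also have "\<dots> = (\<integral>\<^sup>+v. ennreal (w v) * g v \<partial>F)"
      using \<open>hi \<noteq> lo\<close> unfolding nnK
      by (intro nn_integral_cong) (auto simp: space_J space_prior)
    finally show ?thesis .
  qed
  have "emeasure J ?A = (\<integral>\<^sup>+v. ennreal (w v) \<partial>F)"
    using I[of "\<lambda>_. 1"] A by simp
  also have "\<dots> = ennreal (\<integral>v. w v \<partial>F)"
    using wF w(2,3) by (intro nn_integral_eq_integral integrable_const_bound[where B=1]) auto
  finally have p: "measure J ?A = (\<integral>v. w v \<partial>F)"
    using w(2) by (simp add: measure_def integral_nonneg)
  have "(\<integral>x. indicator ?A x * fst x \<partial>J) = enn2real (\<integral>\<^sup>+x. ennreal (indicator ?A x * fst x) \<partial>J)"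
    using A fst_borel_measurable fst_bounds by (intro integral_eq_nn_integral AE_I2) (auto simp: indicator_def)
  also have "(\<integral>\<^sup>+x. ennreal (indicator ?A x * fst x) \<partial>J) = (\<integral>\<^sup>+x. indicator ?A x * ennreal (fst x) \<partial>J)"
    by (intro nn_integral_cong) (auto simp: indicator_def)
  also have "\<dots> = (\<integral>\<^sup>+v. ennreal (w v) * ennreal v \<partial>F)"
    using id_measurable by (intro I) simp
  also have "\<dots> = (\<integral>\<^sup>+v. ennreal (v * w v) \<partial>F)"
    using w(2) by (intro nn_integral_cong) (simp add: ennreal_mult' space_prior mult.commute)
  also have "enn2real \<dots> = (\<integral>v. v * w v \<partial>F)"
    using wF id_measurable w(2) by (intro integral_eq_nn_integral[symmetric] AE_I2) (auto simp: space_prior)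
  finally have "(\<integral>x. indicator ?A x * fst x \<partial>J) = (\<integral>v. v * w v \<partial>F)" .
  then show thesis using that[OF agent_axioms hi p] by simp
qed

subsection \<open>Games with a single slot\<close>

lemma last_sort_eq_Max:
  fixes xs :: "'a::linorder list"
  assumes "xs \<noteq> []"
  shows "last (sort xs) = Max (set xs)"
proof (rule Max_eqI[symmetric])
  have ne: "sort xs \<noteq> []" using assms by (simp flip: length_greater_0_conv)
  fix x assume "x \<in> set xs"
  then obtain k where k: "k < length (sort xs)" "x = sort xs ! k"
    by (metis in_set_conv_nth set_sort)
  then have "sort xs ! k \<le> sort xs ! (length (sort xs) - 1)"
    by (intro sorted_nth_mono) auto
  then show "x \<le> last (sort xs)" using k by (simp add: last_conv_nth[OF ne])
next
  have "sort xs \<noteq> []" using assms by (simp flip: length_greater_0_conv)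
  then show "last (sort xs) \<in> set xs"
    using last_in_set[of "sort xs"] by simp
qed simp

lemma ordered_first:
  assumes "0 < agents I"
  shows "ordered I e 1 = Max (e ` {..<agents I})"
proof -
  let ?xs = "map e [0..<agents I]"
  have "sort ?xs \<noteq> []" using assms by (simp flip: length_greater_0_conv)
  then have "rev (sort ?xs) ! 0 = last (sort ?xs)"
    by (simp add: hd_conv_nth[symmetric] hd_rev)
  also have "\<dots> = Max (e ` {..<agents I})"
    using assms by (subst last_sort_eq_Max) (auto simp: atLeast0LessThan)
  finally show ?thesis by (simp add: ordered_def)
qed

section \<open>Top scorers and uniform tie-breaking\<close>

definition argmax :: "nat \<Rightarrow> (nat \<Rightarrow> real) \<Rightarrow> nat set" where
  "argmax n e = {i\<in>{..<n}. \<forall>j<n. e j \<le> e i}"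

lemma finite_argmax: "finite (argmax n e)"
  by (simp add: argmax_def)

lemma argmax_nonempty:
  assumes "0 < n"
  shows "argmax n e \<noteq> {}"
proof -
  have "Max (e ` {..<n}) \<in> e ` {..<n}" using assms by (intro Max_in) auto
  then obtain i where "i < n" "Max (e ` {..<n}) = e i" by auto
  then have "i \<in> argmax n e" by (auto simp: argmax_def intro!: Max_ge simp flip: \<open>Max _ = e i\<close>)
  then show ?thesis by blast
qed

text \<open>With one slot the top sets are the singletons of the maximizers, so a uniform draw among
  top sets is a uniform draw from \<open>argmax\<close>.\<close>

lemma select_prob_single_slot:
  assumes "slots I = 1" "0 < agents I"
  shows "select_prob I e i = of_bool (i \<in> argmax (agents I) e) / card (argmax (agents I) e)"
proof -
  let ?A = "argmax (agents I) e"
  have "top_sets I e = (\<lambda>j. {j}) ` ?A"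
    using assms(1) by (auto simp: top_sets_def argmax_def card_1_singleton_iff)
  moreover have "card ((\<lambda>j. {j}) ` ?A) = card ?A"
    by (intro card_image) (auto simp: inj_on_def)
  moreover have "(\<lambda>j. {j}) ` ?A \<inter> {S. i \<in> S} = (if i \<in> ?A then {{i}} else {})"
    by auto
  ultimately show ?thesis
    using finite_argmax[of "agents I" e] argmax_nonempty[OF assms(2), of e]
    by (simp add: select_prob_def measure_pmf_of_set)
qed

lemma sum_select_prob_single_slot:
  assumes "slots I = 1" "0 < agents I"
  shows "(\<Sum>i<agents I. select_prob I e i) = 1"
proof -
  let ?A = "argmax (agents I) e"
  have "(\<Sum>i<agents I. of_bool (i \<in> ?A)) = real (card ({..<agents I} \<inter> ?A))"
    by (simp add: sum_of_bool_eq)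
  also have "{..<agents I} \<inter> ?A = ?A" by (auto simp: argmax_def)
  finally show ?thesis
    using finite_argmax argmax_nonempty[OF assms(2)]
    by (simp add: select_prob_single_slot[OF assms] card_gt_0_iff flip: sum_divide_distrib)
qed

text \<open>\<open>Z\<close> is any profile of schemes, not necessarily an equilibrium, so that the
  results below also apply to the profile after a unilateral deviation.\<close>

locale single_slot_game =
  fixes I :: game and F :: "real measure" and Z :: "'s profile"
  assumes agents_pos: "0 < agents I"
    and slots: "slots I = 1"
    and prior_eq: "\<And>i. i < agents I \<Longrightarrow> prior I i = F"
    and prob_space_prior: "prob_space F"
    and sets_prior: "sets F = sets unit_interval"
    and schemes: "\<And>i. i < agents I \<Longrightarrow> signaling_scheme (Z i)"
    and util_one: "\<And>i v. i < agents I \<Longrightarrow> v \<in> {0..1} \<Longrightarrow> util I i v = 1"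
begin

abbreviation N :: nat where "N \<equiv> agents I"
abbreviation J :: "nat \<Rightarrow> (real \<times> 's) measure" where "J i \<equiv> joint_law F (Z i)"
abbreviation e :: "nat \<Rightarrow> real \<times> 's \<Rightarrow> real" where "e i \<equiv> posterior F (Z i) (\<lambda>v. v)"
abbreviation P :: "(nat \<Rightarrow> real \<times> 's) measure" where "P \<equiv> outcome_law I Z"

lemma agent: "i < N \<Longrightarrow> agent F (Z i)"
  by (intro agent.intro agent_axioms.intro prob_space_prior sets_prior schemes)

lemma prob_space_J: "i < N \<Longrightarrow> prob_space (J i)"
  by (rule agent.prob_space_joint_law[OF agent])

lemma outcome_law_eq: "P = Pi\<^sub>M {..<N} J"
  unfolding outcome_law_def by (intro PiM_cong refl) (simp add: prior_eq)

sublocale P: prob_space P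
  unfolding outcome_law_eq by (intro prob_space_PiM prob_space_J) simp

lemma post_mean_eq: "i < N \<Longrightarrow> post_mean I Z \<omega> i = e i (\<omega> i)"
  by (simp add: post_mean_def prior_eq)

lemma component_measurable: "i < N \<Longrightarrow> (\<lambda>\<omega>. \<omega> i) \<in> P \<rightarrow>\<^sub>M J i"
  unfolding outcome_law_eq by (intro measurable_component_singleton) simp

lemma AE_component:
  assumes "i < N" "AE x in J i. Q x"
  shows "AE \<omega> in P. Q (\<omega> i)"
  unfolding outcome_law_eq using assms by (intro AE_PiM_component prob_space_J) auto

lemma distr_component: "i < N \<Longrightarrow> distr P (J i) (\<lambda>\<omega>. \<omega> i) = J i"
  unfolding outcome_law_eq by (intro distr_PiM_component prob_space_J) auto

lemma post_mean_measurable: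
  assumes "i < N"
  shows "(\<lambda>\<omega>. post_mean I Z \<omega> i) \<in> borel_measurable P"
  using measurable_compose[OF component_measurable agent.posterior_measurable[OF agent]] assms
  by (simp add: post_mean_eq)

lemma post_mean_integrable:
  assumes "i < N"
  shows "integrable P (\<lambda>\<omega>. post_mean I Z \<omega> i)"
proof -
  have "integrable (distr P (J i) (\<lambda>\<omega>. \<omega> i)) (e i)"
    using assms by (simp add: distr_component agent.integrable_posterior_mean[OF agent])
  then show ?thesis
    using assms by (simp add: post_mean_eq integrable_distr_eq component_measurable agent.posterior_measurable[OF agent])
qed

lemma AE_post_mean_nonneg:
  assumes "i < N"
  shows "AE \<omega> in P. 0 \<le> post_mean I Z \<omega> i"
  using AE_component[OF assms agent.AE_posterior_mean_nonneg[OF agent[OF assms]]] assms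
  by (simp add: post_mean_eq)

section \<open>Selection probabilities and payoffs\<close>

lemma argmax_measurable:
  assumes "i < N"
  shows "{\<omega>\<in>space P. i \<in> argmax N (post_mean I Z \<omega>)} \<in> sets P"
proof -
  have "(\<Inter>j\<in>{..<N}. {\<omega>\<in>space P. post_mean I Z \<omega> j \<le> post_mean I Z \<omega> i}) \<in> sets P"
  proof (rule sets.finite_INT)
    fix j assume "j \<in> {..<N}"
    then show "{\<omega>\<in>space P. post_mean I Z \<omega> j \<le> post_mean I Z \<omega> i} \<in> sets P"
      using assms by (intro borel_measurable_le post_mean_measurable) auto
  qed (use agents_pos in auto)
  also have "(\<Inter>j\<in>{..<N}. {\<omega>\<in>space P. post_mean I Z \<omega> j \<le> post_mean I Z \<omega> i}) =
      {\<omega>\<in>space P. i \<in> argmax N (post_mean I Z \<omega>)}"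
    using assms agents_pos by (auto simp: argmax_def)
  finally show ?thesis .
qed

lemma select_prob_measurable:
  assumes "i < N"
  shows "(\<lambda>\<omega>. select_prob I (post_mean I Z \<omega>) i) \<in> borel_measurable P"
proof -
  \<comment> \<open>Writing the number of tied agents as a sum of indicators reduces its
    measurability to \<open>argmax_measurable\<close>.\<close>
  have "card (argmax N g) = (\<Sum>j<N. of_bool (j \<in> argmax N g))" for g
  proof -
    have "argmax N g = {..<N} \<inter> argmax N g" by (auto simp: argmax_def)
    then show ?thesis by (simp add: sum_of_bool_eq Int_def)
  qed
  then have c: "real (card (argmax N g)) = (\<Sum>j<N. of_bool (j \<in> argmax N g))" for g
    by simp
  show ?thesis
    unfolding select_prob_single_slot[OF slots agents_pos] c
    using argmax_measurable assms unfolding of_bool_def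
    by (intro borel_measurable_divide borel_measurable_sum measurable_If measurable_const) auto
qed

lemma select_prob_bounds: "0 \<le> select_prob I g i" "select_prob I g i \<le> 1"
  by (auto simp: select_prob_def)

lemma select_prob_integrable:
  assumes "i < N"
  shows "integrable P (\<lambda>\<omega>. select_prob I (post_mean I Z \<omega>) i)"
  using select_prob_measurable[OF assms] select_prob_bounds
  by (intro P.integrable_const_bound[where B=1]) auto

text \<open>Constant utility has posterior expectation 1 almost surely, so the payoff is just the
  probability of being selected.\<close>

lemma payoff_eq:
  assumes "i < N"
  shows "payoff I Z i = (\<integral>\<omega>. select_prob I (post_mean I Z \<omega>) i \<partial>P)"
  unfolding payoff_def
proof (rule integral_cong_AE)
  have "AE \<omega> in P. posterior F (Z i) (util I i) (\<omega> i) = 1"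
    using assms by (intro AE_component agent.AE_posterior_one agent util_one)
  then show "AE \<omega> in P. select_prob I (post_mean I Z \<omega>) i * posterior (prior I i) (Z i) (util I i) (\<omega> i) =
      select_prob I (post_mean I Z \<omega>) i"
    by eventually_elim (simp add: prior_eq assms)
  have "(\<lambda>\<omega>. posterior F (Z i) (util I i) (\<omega> i)) \<in> borel_measurable P"
    using assms by (intro measurable_compose[OF component_measurable agent.posterior_measurable[OF agent]])
  then show "(\<lambda>\<omega>. select_prob I (post_mean I Z \<omega>) i * posterior (prior I i) (Z i) (util I i) (\<omega> i))
      \<in> borel_measurable P"
    using select_prob_measurable[OF assms] by (simp add: prior_eq assms)
qed (rule select_prob_measurable[OF assms])

lemma sum_payoff: "(\<Sum>i<N. payoff I Z i) = 1"
proof -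
  have "(\<Sum>i<N. payoff I Z i) = (\<integral>\<omega>. (\<Sum>i<N. select_prob I (post_mean I Z \<omega>) i) \<partial>P)"
    using select_prob_integrable by (simp add: payoff_eq Bochner_Integration.integral_sum)
  then show ?thesis
    by (simp add: sum_select_prob_single_slot[OF slots agents_pos] P.prob_space)
qed

text \<open>The \<open>N\<close> payoffs sum to 1, so they cannot all exceed their average.\<close>

lemma exists_small_payoff: "\<exists>i<N. payoff I Z i \<le> 1 / N"
proof (rule ccontr)
  assume "\<not> ?thesis"
  then have "(\<Sum>i<N. 1 / real N) < (\<Sum>i<N. payoff I Z i)"
    using agents_pos by (intro sum_strict_mono) auto
  then show False using agents_pos by (simp add: sum_payoff)
qed

section \<open>The event that all other agents stay below a level\<close>

lemma below_sets: "i < N \<Longrightarrow> {x\<in>space (J i). e i x < m} \<in> sets (J i)"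
  using agent.posterior_measurable[OF agent, of i "\<lambda>v. v"] by measurable

text \<open>The event is a box in the product space, so its probability factorizes. Below,
  \<open>A\<close> is either a high-signal event of agent \<open>i\<close> or the whole space; the
  remaining product does not involve the scheme of \<open>i\<close>.\<close>

lemma measure_all_others_below:
  assumes i: "i < N" and A: "A \<in> sets (J i)"
  shows "measure P {\<omega>\<in>space P. \<omega> i \<in> A \<and> (\<forall>j\<in>{..<N}-{i}. e j (\<omega> j) < m)} =
    measure (J i) A * (\<Prod>j\<in>{..<N}-{i}. measure (J j) {x\<in>space (J j). e j x < m})"
    and all_others_below_sets:
    "{\<omega>\<in>space P. \<omega> i \<in> A \<and> (\<forall>j\<in>{..<N}-{i}. e j (\<omega> j) < m)} \<in> sets P"
proof -
  define B where "B j = (if j = i then A else {x\<in>space (J j). e j x < m})" for j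
  have B_i: "B i = A" by (simp add: B_def)
  have B: "B j \<in> sets (J j)" if "j < N" for j
    using that A below_sets by (auto simp: B_def)
  have eq: "{\<omega>\<in>space P. \<omega> i \<in> A \<and> (\<forall>j\<in>{..<N}-{i}. e j (\<omega> j) < m)} = Pi\<^sub>E {..<N} B"
  proof (intro set_eqI iffI)
    fix \<omega> assume \<omega>: "\<omega> \<in> Pi\<^sub>E {..<N} B"
    then have B_mem: "\<omega> j \<in> B j" if "j < N" for j using that by (auto dest: PiE_mem)
    have "\<omega> \<in> space P"
      using \<omega> sets.sets_into_space[OF B] by (auto simp: outcome_law_eq space_PiM PiE_iff)
    moreover have "\<omega> i \<in> A" using B_mem[OF i] by (simp add: B_def)
    moreover have "e j (\<omega> j) < m" if "j \<in> {..<N} - {i}" for j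
      using B_mem[of j] that by (simp add: B_def)
    ultimately show "\<omega> \<in> {\<omega>\<in>space P. \<omega> i \<in> A \<and> (\<forall>j\<in>{..<N}-{i}. e j (\<omega> j) < m)}" by blast
  qed (auto simp: B_def outcome_law_eq space_PiM PiE_iff)
  have "measure P (Pi\<^sub>E {..<N} B) = (\<Prod>j<N. measure (J j) (B j))"
    unfolding outcome_law_eq using B by (intro measure_PiM_box prob_space_J) auto
  also have "\<dots> = measure (J i) (B i) * (\<Prod>j\<in>{..<N}-{i}. measure (J j) (B j))"
    using i by (intro prod.remove) auto
  also have "(\<Prod>j\<in>{..<N}-{i}. measure (J j) (B j)) =
      (\<Prod>j\<in>{..<N}-{i}. measure (J j) {x\<in>space (J j). e j x < m})"
    by (intro prod.cong) (auto simp: B_def)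
  finally show "measure P {\<omega>\<in>space P. \<omega> i \<in> A \<and> (\<forall>j\<in>{..<N}-{i}. e j (\<omega> j) < m)} =
    measure (J i) A * (\<Prod>j\<in>{..<N}-{i}. measure (J j) {x\<in>space (J j). e j x < m})"
    unfolding eq B_i .
  show "{\<omega>\<in>space P. \<omega> i \<in> A \<and> (\<forall>j\<in>{..<N}-{i}. e j (\<omega> j) < m)} \<in> sets P"
    unfolding eq unfolding outcome_law_eq using B by (intro sets_PiM_I_finite) auto
qed

text \<open>On this event agent \<open>i\<close> has at least \<open>m\<close> and every other agent
  strictly less. Hence \<open>i\<close> is the unique maximizer and is selected for sure, whatever
  the tie-breaking.\<close>

lemma payoff_ge:
  assumes i: "i < N" and A: "A \<in> sets (J i)" and ge: "\<And>x. x \<in> A \<Longrightarrow> m \<le> e i x"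
  shows "measure (J i) A * (\<Prod>j\<in>{..<N}-{i}. measure (J j) {x\<in>space (J j). e j x < m}) \<le> payoff I Z i"
proof -
  let ?B = "{\<omega>\<in>space P. \<omega> i \<in> A \<and> (\<forall>j\<in>{..<N}-{i}. e j (\<omega> j) < m)}"
  have "indicator ?B \<omega> \<le> select_prob I (post_mean I Z \<omega>) i" for \<omega>
  proof (cases "\<omega> \<in> ?B")
    case True
    then have "post_mean I Z \<omega> j < post_mean I Z \<omega> i" if "j < N" "j \<noteq> i" for j
      using that ge[of "\<omega> i"] i by (force simp: post_mean_eq)
    then have "argmax N (post_mean I Z \<omega>) = {i}"
      using i by (fastforce simp: argmax_def)
    then show ?thesis
      by (simp add: select_prob_single_slot[OF slots agents_pos])
  qed (simp add: select_prob_bounds)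
  then have "(\<integral>\<omega>. indicator ?B \<omega> \<partial>P) \<le> payoff I Z i"
    unfolding payoff_eq[OF i] using all_others_below_sets[OF i A, of m] select_prob_integrable[OF i]
    by (intro integral_mono integrable_real_indicator) (auto simp: P.emeasure_eq_measure)
  then show ?thesis
    using all_others_below_sets[OF i A, of m] by (simp add: measure_all_others_below[OF i A])
qed

section \<open>Lower bounds on the welfare of a profile\<close>

lemma welfare_eq: "welfare I Z = (\<integral>\<omega>. Max (post_mean I Z \<omega> ` {..<N}) \<partial>P)"
  using ordered_first[OF agents_pos] by (simp add: welfare_def slots)

lemma Max_post_mean_integrable: "integrable P (\<lambda>\<omega>. Max (post_mean I Z \<omega> ` {..<N}))"
proof (rule Bochner_Integration.integrable_bound)
  show "integrable P (\<lambda>\<omega>. \<Sum>i<N. \<bar>post_mean I Z \<omega> i\<bar>)"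
    using post_mean_integrable by auto
  show "(\<lambda>\<omega>. Max (post_mean I Z \<omega> ` {..<N})) \<in> borel_measurable P"
    using post_mean_measurable agents_pos by (intro borel_measurable_Max) auto
  have "\<bar>Max (g ` {..<N})\<bar> \<le> (\<Sum>i<N. \<bar>g i\<bar>)" for g :: "nat \<Rightarrow> real"
  proof -
    have "Max (g ` {..<N}) \<in> g ` {..<N}" using agents_pos by (intro Max_in) auto
    then show ?thesis by (auto intro!: member_le_sum[of _ "{..<N}" "\<lambda>i. \<bar>g i\<bar>"])
  qed
  then show "AE \<omega> in P. norm (Max (post_mean I Z \<omega> ` {..<N})) \<le> norm (\<Sum>i<N. \<bar>post_mean I Z \<omega> i\<bar>)"
    by (simp add: sum_nonneg)
qed

text \<open>A posterior mean averages to the prior mean, and the maximum dominates each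
  coordinate.\<close>

lemma prior_mean_le_welfare:
  assumes "i < N"
  shows "(\<integral>v. v \<partial>F) \<le> welfare I Z"
proof -
  have "(\<integral>v. v \<partial>F) = (\<integral>x. e i x \<partial>distr P (J i) (\<lambda>\<omega>. \<omega> i))"
    using assms by (simp add: distr_component agent.integral_posterior_mean[OF agent])
  also have "\<dots> = (\<integral>\<omega>. post_mean I Z \<omega> i \<partial>P)"
    using assms by (simp add: integral_distr component_measurable agent.posterior_measurable[OF agent] post_mean_eq)
  also have "\<dots> \<le> welfare I Z"
    unfolding welfare_eq using assms
    by (intro integral_mono post_mean_integrable Max_post_mean_integrable) auto
  finally show ?thesis .
qed

text \<open>A Markov-type bound: unless all agents other than \<open>i\<close> are below
  \<open>m\<close>, the maximum is at least \<open>m\<close>; otherwise it is almost surely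
  nonnegative because the posterior mean of \<open>i\<close> is. Agent \<open>i\<close> is left out
  so that the same product appears as in \<open>payoff_ge\<close>.\<close>

lemma welfare_ge:
  assumes i: "i < N" and m: "0 \<le> m"
  shows "m * (1 - (\<Prod>j\<in>{..<N}-{i}. measure (J j) {x\<in>space (J j). e j x < m})) \<le> welfare I Z"
proof -
  let ?B = "{\<omega>\<in>space P. \<omega> i \<in> space (J i) \<and> (\<forall>j\<in>{..<N}-{i}. e j (\<omega> j) < m)}"
  have B: "?B \<in> sets P" by (rule all_others_below_sets[OF i sets.top])
  have "measure (J i) (space (J i)) = 1" by (rule prob_space.prob_space[OF prob_space_J[OF i]])
  then have "m * (1 - (\<Prod>j\<in>{..<N}-{i}. measure (J j) {x\<in>space (J j). e j x < m})) = m * measure P (space P - ?B)"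
    using measure_all_others_below[OF i sets.top, of m] B by (simp add: P.prob_compl)
  also have "\<dots> = (\<integral>\<omega>. m * indicator (space P - ?B) \<omega> \<partial>P)"
    using B by simp
  also have "\<dots> \<le> welfare I Z"
    unfolding welfare_eq
  proof (intro integral_mono_AE Max_post_mean_integrable)
    show "integrable P (\<lambda>\<omega>. m * indicator (space P - ?B) \<omega>)"
      using B by (intro integrable_mult_right integrable_real_indicator) (auto simp: P.emeasure_eq_measure)
    show "AE \<omega> in P. m * indicator (space P - ?B) \<omega> \<le> Max (post_mean I Z \<omega> ` {..<N})"
      using AE_post_mean_nonneg[OF i]
    proof (eventually_elim)
      fix \<omega> assume nonneg: "0 \<le> post_mean I Z \<omega> i"
      have Max: "post_mean I Z \<omega> j \<le> Max (post_mean I Z \<omega> ` {..<N})" if "j < N" for j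
        using that by (intro Max_ge) auto
      show "m * indicator (space P - ?B) \<omega> \<le> Max (post_mean I Z \<omega> ` {..<N})"
      proof (cases "\<omega> \<in> space P - ?B")
        case True
        then obtain j where "j < N" "m \<le> e j (\<omega> j)"
          using measurable_space[OF component_measurable[OF i]] by force
        then have "m \<le> Max (post_mean I Z \<omega> ` {..<N})"
          using Max[of j] post_mean_eq[of j \<omega>] by linarith
        then show ?thesis using True by simp
      qed (use nonneg Max[OF i] in auto)
    qed
  qed
  finally show ?thesis .
qed

section \<open>Upper bound on the first-best welfare\<close>

lemma max_welfare_eq: "max_welfare I = (\<integral>v. Max (v ` {..<N}) \<partial>Pi\<^sub>M {..<N} (\<lambda>_. F))"
proof -
  have "{S. S \<subseteq> {..<N} \<and> card S = slots I} = (\<lambda>i. {i}) ` {..<N}"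
    by (auto simp: slots card_1_singleton_iff)
  moreover have "Pi\<^sub>M {..<N} (prior I) = Pi\<^sub>M {..<N} (\<lambda>_. F)"
    by (intro PiM_cong refl) (simp add: prior_eq)
  ultimately show ?thesis by (simp add: max_welfare_def image_image)
qed

text \<open>The maximum is attained at some coordinate, whose excess over \<open>t\<close> is one of
  the nonnegative summands. Each coordinate has law \<open>F\<close>, so the \<open>N\<close>
  expected excesses coincide.\<close>

lemma max_welfare_le:
  assumes t: "0 \<le> t"
  shows "max_welfare I \<le> t + N * (\<integral>v. max 0 (v - t) \<partial>F)"
proof -
  interpret F: prob_space F by (rule prob_space_prior)
  let ?Q = "Pi\<^sub>M {..<N} (\<lambda>_. F)"
  interpret Q: prob_space ?Q by (intro prob_space_PiM prob_space_prior)
  have space_F: "space F = {0..1}"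
    using sets_eq_imp_space_eq[OF sets_prior] by (simp add: space_restrict_space)
  have id: "(\<lambda>v. v) \<in> borel_measurable F"
    using sets_prior by (simp add: measurable_restrict_space1 cong: measurable_cong_sets)
  have comp: "(\<lambda>v. v i) \<in> borel_measurable ?Q" if "i < N" for i
    using that by (intro measurable_compose[OF _ id] measurable_component_singleton) auto
  have range: "0 \<le> v i \<and> v i \<le> 1" if "v \<in> space ?Q" "i < N" for v i
    using that PiE_mem[of v "{..<N}" "\<lambda>_. {0..1}" i] by (simp add: space_PiM space_F)
  have int: "integrable ?Q (\<lambda>v. max 0 (v i - t))" if "i < N" for i
  proof (rule Q.integrable_const_bound[where B=1])
    show "AE v in ?Q. norm (max 0 (v i - t)) \<le> 1"
    proof (rule AE_I2)
      fix v assume "v \<in> space ?Q"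
      then have "v i - t \<le> 1" using range[of v i] that t by linarith
      then show "norm (max 0 (v i - t)) \<le> 1" by simp
    qed
  qed (use comp[OF that] in measurable)
  have marg: "(\<integral>v. max 0 (v i - t) \<partial>?Q) = (\<integral>v. max 0 (v - t) \<partial>F)" if "i < N" for i
  proof -
    have "(\<integral>v. max 0 (v - t) \<partial>distr ?Q F (\<lambda>v. v i)) = (\<integral>v. max 0 (v i - t) \<partial>?Q)"
      using that id by (intro integral_distr measurable_component_singleton) auto
    moreover have "distr ?Q F (\<lambda>v. v i) = F"
      using that distr_PiM_component[of "{..<N}" "\<lambda>_. F" i] prob_space_prior by simp
    ultimately show ?thesis by simp
  qed
  have Max_in: "Max (v ` {..<N}) \<in> v ` {..<N}" for v :: "nat \<Rightarrow> real"
    using agents_pos by (intro Max_in) auto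
  have "max_welfare I \<le> (\<integral>v. t + (\<Sum>i<N. max 0 (v i - t)) \<partial>?Q)"
    unfolding max_welfare_eq
  proof (rule integral_mono)
    have "(\<lambda>v. Max (v ` {..<N})) \<in> borel_measurable ?Q"
      using comp agents_pos by (intro borel_measurable_Max) auto
    moreover have "\<bar>Max (v ` {..<N})\<bar> \<le> 1" if "v \<in> space ?Q" for v
      using Max_in[of v] range[OF that] by auto
    ultimately show "integrable ?Q (\<lambda>v. Max (v ` {..<N}))"
      by (intro Q.integrable_const_bound[where B=1] AE_I2) auto
    show "integrable ?Q (\<lambda>v. t + (\<Sum>i<N. max 0 (v i - t)))"
      using int by (intro Bochner_Integration.integrable_add Bochner_Integration.integrable_sum) auto
    fix v assume "v \<in> space ?Q"
    obtain i where i: "i < N" "Max (v ` {..<N}) = v i" using Max_in[of v] by auto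
    have "max 0 (v i - t) \<le> (\<Sum>i<N. max 0 (v i - t))"
      using i by (intro member_le_sum) auto
    then show "Max (v ` {..<N}) \<le> t + (\<Sum>i<N. max 0 (v i - t))" using i by linarith
  qed
  also have "\<dots> = t + (\<integral>v. (\<Sum>i<N. max 0 (v i - t)) \<partial>?Q)"
    using int by (subst Bochner_Integration.integral_add) (auto simp: Q.prob_space)
  also have "(\<integral>v. (\<Sum>i<N. max 0 (v i - t)) \<partial>?Q) = (\<Sum>i<N. \<integral>v. max 0 (v i - t) \<partial>?Q)"
    using int by (intro Bochner_Integration.integral_sum) auto
  also have "\<dots> = N * (\<integral>v. max 0 (v - t) \<partial>F)"
    using marg by simp
  finally show ?thesis .
qed

end

subsection \<open>The welfare of an equilibrium\<close>

text \<open>Two distinct signals suffice, as the equilibrium condition is tested only against a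
  binary scheme.\<close>

lemma (in single_slot_game) nash_welfare_bound:
  fixes hi lo :: 's
  assumes hi_lo: "hi \<noteq> lo" and nash: "nash_equilibrium I Z"
  shows "max_welfare I \<le> 4 * welfare I Z"
proof -
  interpret F: prob_space F by (rule prob_space_prior)
  have agent0: "agent F (Z 0)" by (rule agent[OF agents_pos])
  have space_F: "space F = {0..1}" by (rule agent.space_prior[OF agent0])
  have id: "(\<lambda>v. v) \<in> borel_measurable F" by (rule agent.id_measurable[OF agent0])
  show ?thesis
  proof (cases "N = 1")
    case True
    \<comment> \<open>For a single agent both the first best and the lower bound on the welfare
      reduce to the prior mean; the threshold is 0 here.\<close>
    have "max_welfare I \<le> (\<integral>v. max 0 v \<partial>F)" using max_welfare_le[of 0] True by simp
    also have "\<dots> = (\<integral>v. v \<partial>F)"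
      by (intro Bochner_Integration.integral_cong refl) (auto simp: space_F)
    finally have "max_welfare I \<le> (\<integral>v. v \<partial>F)" .
    moreover have "0 \<le> (\<integral>v. v \<partial>F)" by (intro Bochner_Integration.integral_nonneg) (auto simp: space_F)
    ultimately show ?thesis using prior_mean_le_welfare[OF agents_pos] by linarith
  next
    case False
    \<comment> \<open>Twice the average payoff \<open>1/N\<close>: from q * p \<le> 1/N it follows
      that p \<le> 1/2. That \<open>q\<close> is at most 1 uses \<open>N\<close> at least 2.\<close>
    define q where "q = 2 / real N"
    have q: "0 < q" "q \<le> 1" using agents_pos False by (auto simp: q_def divide_simps)
    obtain i where i: "i < N" "payoff I Z i \<le> 1 / N" using exists_small_payoff by blast
    have F_bounds: "0 \<le> v \<and> v \<le> 1" if "v \<in> space F" for v using that by (simp add: space_F)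
    obtain t w where t: "0 \<le> t" and w: "w \<in> borel_measurable borel" "range w \<subseteq> {0..1}"
      and int_w: "(\<integral>v. w v \<partial>F) = q"
      and int_vw: "(\<integral>v. v * w v \<partial>F) = t * q + (\<integral>v. max 0 (v - t) \<partial>F)"
      by (rule F.randomized_threshold[OF id F_bounds q])
    have "w \<in> borel_measurable unit_interval" using w(1) by (rule measurable_restrict_space1)
    from hi_lo prob_space_prior sets_prior this w(2)
    obtain \<zeta> :: "'s scheme" where \<zeta>: "agent F \<zeta>" "{hi} \<in> sets (signals \<zeta>)"
      "measure (joint_law F \<zeta>) {x\<in>space (joint_law F \<zeta>). snd x = hi} = q"
      "(\<integral>x. indicator {x\<in>space (joint_law F \<zeta>). snd x = hi} x * fst x \<partial>joint_law F \<zeta>) =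
        t * q + (\<integral>v. max 0 (v - t) \<partial>F)"
      by (rule binary_scheme[of hi lo F w, unfolded int_w int_vw])
    have scheme: "signaling_scheme \<zeta>" using \<zeta>(1) by (simp add: agent_def agent_axioms_def)
    have "signaling_scheme ((Z(i := \<zeta>)) j)" if "j < N" for j
      using scheme schemes[OF that] by simp
    \<comment> \<open>\<open>payoff_ge\<close> is applied to the deviating profile,
      \<open>welfare_ge\<close> to the original one.\<close>
    then interpret D: single_slot_game I F "Z(i := \<zeta>)"
      using agents_pos slots prior_eq prob_space_prior sets_prior util_one
      by (intro single_slot_game.intro)
    define H where "H = {x\<in>space (joint_law F \<zeta>). snd x = hi}"
    \<comment> \<open>This is the integral of the value over the high-signal event divided by its
      mass \<open>q\<close>, i.e. the posterior mean after \<open>hi\<close>.\<close>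
    define m where "m = t + (\<integral>v. max 0 (v - t) \<partial>F) / q"
    have m: "0 \<le> m" unfolding m_def using t q by (intro add_nonneg_nonneg divide_nonneg_pos) auto
    have H: "H \<in> sets (joint_law F \<zeta>)"
      using measurable_sets[OF agent.snd_measurable[OF \<zeta>(1)] \<zeta>(2)]
      by (simp add: H_def vimage_def Int_def conj_commute)
    have high_mean: "posterior F \<zeta> (\<lambda>v. v) x = m" if "x \<in> H" for x
    proof -
      have "posterior F \<zeta> (\<lambda>v. v) x * q = t * q + (\<integral>v. max 0 (v - t) \<partial>F)"
        using agent.posterior_mean_atom[OF \<zeta>(1,2), of x] that \<zeta>(3,4) by (simp add: H_def)
      then show ?thesis using q by (simp add: m_def field_simps)
    qed
    define p where "p = (\<Prod>j\<in>{..<N}-{i}. measure (J j) {x\<in>space (J j). e j x < m})"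
    \<comment> \<open>The deviation changes only the scheme of \<open>i\<close>, so the factors for
      the other agents agree in both profiles.\<close>
    have "q * p = measure (D.J i) H * (\<Prod>j\<in>{..<N}-{i}. measure (D.J j) {x\<in>space (D.J j). D.e j x < m})"
      unfolding p_def using \<zeta>(3) by (intro arg_cong2[where f="(*)"] prod.cong) (auto simp: H_def)
    also have "\<dots> \<le> payoff I (Z(i := \<zeta>)) i"
      using i(1) H high_mean by (intro D.payoff_ge) auto
    also have "\<dots> \<le> 1 / N"
      using nash i scheme unfolding nash_equilibrium_def by force
    finally have "p \<le> 1 / 2" using agents_pos by (simp add: q_def field_simps)
    then have "m * (1 / 2) \<le> m * (1 - p)" using m by (intro mult_left_mono) auto
    also have "\<dots> \<le> welfare I Z" unfolding p_def by (rule welfare_ge[OF i(1) m])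
    finally have "2 * m \<le> 4 * welfare I Z" by simp
    moreover have "max_welfare I \<le> t + N * (\<integral>v. max 0 (v - t) \<partial>F)" by (rule max_welfare_le[OF t])
    \<comment> \<open>Since 1/q = N/2, twice \<open>m\<close> exceeds the first-best bound by
      exactly \<open>t\<close>, which is nonnegative.\<close>
    moreover have "2 * m = 2 * t + N * (\<integral>v. max 0 (v - t) \<partial>F)" by (simp add: m_def q_def)
    ultimately show ?thesis using t by linarith
  qed
qed

theorem theorem4p1:
  fixes I :: game and F :: "real measure" and emb :: "real \<Rightarrow> 's"
  assumes "inj emb"
    and "valid_game I"
    and "slots I = 1"
    and "\<And>i. i < agents I \<Longrightarrow> prior I i = F"
    and "\<And>i v. i < agents I \<Longrightarrow> v \<in> {0..1} \<Longrightarrow> util I i v = 1"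
  shows "(\<forall>Z :: 's profile. nash_equilibrium I Z \<longrightarrow> max_welfare I \<le> 4 * welfare I Z) \<and>
         price_of_anarchy TYPE('s) I \<le> 4"
proof
  show bound: "\<forall>Z :: 's profile. nash_equilibrium I Z \<longrightarrow> max_welfare I \<le> 4 * welfare I Z"
  proof (intro allI impI)
    fix Z :: "'s profile" assume nash: "nash_equilibrium I Z"
    have pos: "0 < agents I" using assms(2,3) by (simp add: valid_game_def)
    have "prob_space (prior I 0) \<and> sets (prior I 0) = sets unit_interval"
      using assms(2) pos unfolding valid_game_def by blast
    then have "prob_space F" "sets F = sets unit_interval"
      by (simp_all only: assms(4)[OF pos])
    moreover have "signaling_scheme (Z i)" if "i < agents I" for i
      using nash that unfolding nash_equilibrium_def by blast
    ultimately interpret single_slot_game I F Z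
      using pos assms(3-5) by (intro single_slot_game.intro)
    \<comment> \<open>These serve as the high and the low signal of the deviation.\<close>
    have "emb 0 \<noteq> emb 1" using assms(1) by (simp add: inj_eq)
    then show "max_welfare I \<le> 4 * welfare I Z" using nash by (rule nash_welfare_bound)
  qed
  define W :: ennreal where "W = (INF Z\<in>{Z :: 's profile. nash_equilibrium I Z}. ennreal (welfare I Z))"
  \<comment> \<open>Dividing by 4 first gives a common lower bound for all equilibrium welfares,
    hence for their infimum, even if there is no equilibrium and \<open>W\<close> is
    infinite.\<close>
  have "ennreal (max_welfare I) / 4 \<le> W"
    unfolding W_def
  proof (rule INF_greatest)
    fix Z :: "'s profile" assume "Z \<in> {Z. nash_equilibrium I Z}"
    then have "ennreal (max_welfare I) \<le> 4 * ennreal (welfare I Z)"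
      using bound by (simp add: ennreal_leI flip: ennreal_numeral ennreal_mult')
    then show "ennreal (max_welfare I) / 4 \<le> ennreal (welfare I Z)"
      by (intro divide_le_posI_ennreal) auto
  qed
  then have "ennreal (max_welfare I) / 4 * 4 \<le> W * 4"
    by (rule mult_right_mono) simp
  then have le: "ennreal (max_welfare I) \<le> W * 4"
    by (simp add: ennreal_divide_times)
  show "price_of_anarchy TYPE('s) I \<le> 4"
    unfolding price_of_anarchy_def W_def[symmetric]
  proof (cases "W = 0")
    \<comment> \<open>Here \<open>le\<close> forces the numerator to be 0 as well, and the ratio is
      \<open>0 / 0 = 0\<close>.\<close>
    case True
    then show "ennreal (max_welfare I) / W \<le> 4" using le by simp
  next
    case False
    then show "ennreal (max_welfare I) / W \<le> 4"
      using le by (intro divide_le_posI_ennreal) (auto simp: zero_less_iff_neq_zero)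
  qed
qed

end
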